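(* Let $G=(V,E)$ be a graph, and let $\Gamma$ be either $\mathbb{R}$ or $\mathbb{R}/2\pi\mathbb{Z}$. For each edge $e\in E$ let $f_e:\Gamma\to\mathbb{R}$ be an odd function such that $|f_e^{-1}(y)|\le d<\infty$ for every $y\in\mathbb{R}$, where $d$ is a constant independent of $e$ and $y$. Fix $\omega\in\mathbb{R}^V$ and let $X=\{x\in\Gamma^V:\dot x=0\}$ be the set of equilibria of the vector field $$\dot x_v=\omega_v+\sum_{w\in N(v)}f_{\{w,v\}}(x_w-x_v),\qquad v\in V.$$ Let $F$ be an induced forest in $G$ without isolated vertices, with $l(F)$ leaves and $c(F)$ connected components. Then the analytic dimension of $X$ satisfies $$\dim_{\mathrm{an}}(X)\le |G|-|F|+l(F)-c(F).$$ In particular, the right hand side is an upper bound to the maximum dimension of a manifold of equilibria.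
   Context: A graph $G=(V,E)$ is a pair of finite sets with $V\neq\emptyset$ and $E$ a set of $2$-element subsets of $V$; $|G|=|V|$ and $N(v)$ is the set of neighbors of $v$. An induced forest is an induced subgraph that is a forest; its isolated vertices and leaves are its vertices of degree $0$ and $1$, respectively, inside it. The analytic dimension $\dim_{\mathrm{an}}(X)$ is the maximum dimension of a manifold (smooth embedded submanifold of $\Gamma^V$) contained in $X$; if $X$ is empty the bound is understood to hold trivially. *)

theory Defs
  imports "HOL-Analysis.Analysis"
begin

definition is_graph :: "'v set \<Rightarrow> 'v set set \<Rightarrow> bool" where
  "is_graph V E \<longleftrightarrow> finite V \<and> V \<noteq> {} \<and> (\<forall>e\<in>E. e \<subseteq> V \<and> card e = 2)"

definition neighbours :: "'v set set \<Rightarrow> 'v \<Rightarrow> 'v set" where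
  "neighbours E v = {w. {w, v} \<in> E}"

definition induced_edges :: "'v set set \<Rightarrow> 'v set \<Rightarrow> 'v set set" where
  "induced_edges E S = {e \<in> E. e \<subseteq> S}"

definition is_cycle :: "'v set set \<Rightarrow> 'v list \<Rightarrow> bool" where
  "is_cycle E vs \<longleftrightarrow> 3 \<le> length vs \<and> distinct vs \<and>
     (\<forall>i<length vs. {vs ! i, vs ! (Suc i mod length vs)} \<in> E)"

definition is_forest :: "'v set \<Rightarrow> 'v set set \<Rightarrow> bool" where
  "is_forest V E \<longleftrightarrow> is_graph V E \<and> (\<nexists>vs. is_cycle E vs)"

definition isolated_vertices :: "'v set \<Rightarrow> 'v set set \<Rightarrow> 'v set" where
  "isolated_vertices V E = {v \<in> V. card (neighbours E v) = 0}"

definition leaves :: "'v set \<Rightarrow> 'v set set \<Rightarrow> 'v set" where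
  "leaves V E = {v \<in> V. card (neighbours E v) = 1}"

definition connected_components :: "'v set \<Rightarrow> 'v set set \<Rightarrow> 'v set set" where
  "connected_components V E =
     V // {(u, w). u \<in> V \<and> w \<in> V \<and> (u, w) \<in> {(a, b). {a, b} \<in> E}\<^sup>*}"

definition eq_mod_2pi :: "real \<Rightarrow> real \<Rightarrow> bool" where
  "eq_mod_2pi x y \<longleftrightarrow> (\<exists>k::int. x - y = 2 * pi * of_int k)"

lemma equivp_eq_mod_2pi: "equivp eq_mod_2pi"
proof (rule equivpI)
  show "reflp eq_mod_2pi"
    by (rule reflpI) (auto simp: eq_mod_2pi_def intro: exI[of _ 0])
  show "symp eq_mod_2pi"
  proof (rule sympI)
    fix x y assume "eq_mod_2pi x y"
    then obtain k :: int where "x - y = 2 * pi * of_int k"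
      by (auto simp: eq_mod_2pi_def)
    then have "y - x = 2 * pi * of_int (- k)" by simp
    then show "eq_mod_2pi y x" unfolding eq_mod_2pi_def by blast
  qed
  show "transp eq_mod_2pi"
  proof (rule transpI)
    fix x y z assume "eq_mod_2pi x y" "eq_mod_2pi y z"
    then obtain k l :: int where "x - y = 2 * pi * of_int k" "y - z = 2 * pi * of_int l"
      by (auto simp: eq_mod_2pi_def)
    then have "x - z = 2 * pi * of_int (k + l)" by (simp add: algebra_simps)
    then show "eq_mod_2pi x z" unfolding eq_mod_2pi_def by blast
  qed
qed

quotient_type circle = real / eq_mod_2pi
  morphisms rep_circle to_circle
  by (rule equivp_eq_mod_2pi)

instantiation circle :: ab_group_add
begin

lift_definition zero_circle :: circle is 0 .

lift_definition plus_circle :: "circle \<Rightarrow> circle \<Rightarrow> circle" is "(+)"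
proof -
  fix a b c d assume "eq_mod_2pi a b" "eq_mod_2pi c d"
  then obtain k l :: int where "a - b = 2 * pi * of_int k" "c - d = 2 * pi * of_int l"
    by (auto simp: eq_mod_2pi_def)
  then have "(a + c) - (b + d) = 2 * pi * of_int (k + l)" by (simp add: algebra_simps)
  then show "eq_mod_2pi (a + c) (b + d)" unfolding eq_mod_2pi_def by blast
qed

lift_definition uminus_circle :: "circle \<Rightarrow> circle" is uminus
proof -
  fix a b assume "eq_mod_2pi a b"
  then obtain k :: int where "a - b = 2 * pi * of_int k"
    by (auto simp: eq_mod_2pi_def)
  then have "- a - - b = 2 * pi * of_int (- k)" by (simp add: algebra_simps)
  then show "eq_mod_2pi (- a) (- b)" unfolding eq_mod_2pi_def by blast
qed

definition minus_circle :: "circle \<Rightarrow> circle \<Rightarrow> circle" where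
  "minus_circle x y = x + (- y)"

instance
proof
  fix a b c :: circle
  show "a + b + c = a + (b + c)"
    by transfer (auto simp: eq_mod_2pi_def intro: exI[of _ 0])
  show "a + b = b + a"
    by transfer (auto simp: eq_mod_2pi_def intro: exI[of _ 0])
  show "0 + a = a"
    by transfer (auto simp: eq_mod_2pi_def intro: exI[of _ 0])
  show "- a + a = 0"
    by transfer (auto simp: eq_mod_2pi_def intro: exI[of _ 0])
  show "a - b = a + - b"
    by (rule minus_circle_def)
qed

end

instantiation circle :: topological_space
begin

definition open_circle :: "circle set \<Rightarrow> bool" where
  "open_circle U \<longleftrightarrow> open (to_circle -` U)"

instance
proof
  show "open (UNIV :: circle set)" by (simp add: open_circle_def)
  show "open (S \<inter> T)" if "open S" "open T" for S T :: "circle set"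
    using that by (simp add: open_circle_def open_Int)
  show "open (\<Union>K)" if "\<forall>S\<in>K. open S" for K :: "circle set set"
    using that by (simp add: open_circle_def vimage_Union open_UN)
qed

end

text \<open>Derivatives are taken at interior points, so the next two notions are only meant for open \<open>S\<close>.\<close>

fun Ck_on :: "nat \<Rightarrow> ('a::real_normed_vector \<Rightarrow> 'b::real_normed_vector) \<Rightarrow> 'a set \<Rightarrow> bool" where
  "Ck_on 0 f S \<longleftrightarrow> continuous_on S f"
| "Ck_on (Suc n) f S \<longleftrightarrow> (\<forall>x\<in>S. f differentiable (at x)) \<and>
     (\<forall>v. Ck_on n (\<lambda>x. frechet_derivative f (at x) v) S)"

definition smooth_on :: "('a::real_normed_vector \<Rightarrow> 'b::real_normed_vector) \<Rightarrow> 'a set \<Rightarrow> bool" where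
  "smooth_on f S \<longleftrightarrow> (\<forall>n. Ck_on n f S)"

text \<open>
  The line and the circle are treated uniformly through the covering map \<open>q :: real \<Rightarrow> 'g\<close>, which
  is \<open>id\<close> for \<open>\<Gamma> = \<real>\<close> and \<open>to_circle\<close> for \<open>\<Gamma> = \<real>/2\<pi>\<int>\<close>. The smooth structure of \<open>\<Gamma>\<^sup>V\<close> is the one
  for which the componentwise map \<open>\<real>\<^sup>V \<rightarrow> \<Gamma>\<^sup>V\<close> is a local diffeomorphism: a map out of \<open>\<Gamma>\<^sup>V\<close> is smooth
  iff its composition with that map is, and a map into \<open>\<Gamma>\<^sup>V\<close> is smooth iff it has smooth local lifts.
\<close>

definition cover :: "(real \<Rightarrow> 'g) \<Rightarrow> real ^ 'v \<Rightarrow> 'g ^ 'v" where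
  "cover q x = (\<chi> i. q (x $ i))"

definition smooth_from ::
    "(real \<Rightarrow> 'g) \<Rightarrow> ('g ^ 'v \<Rightarrow> real ^ 'v::finite) \<Rightarrow> ('g ^ 'v) set \<Rightarrow> bool" where
  "smooth_from q \<phi> U \<longleftrightarrow> smooth_on (\<phi> \<circ> cover q) (cover q -` U)"

definition smooth_into ::
    "(real \<Rightarrow> 'g) \<Rightarrow> (real ^ 'v::finite \<Rightarrow> 'g ^ 'v) \<Rightarrow> (real ^ 'v) set \<Rightarrow> bool" where
  "smooth_into q \<psi> W \<longleftrightarrow> (\<forall>y\<in>W. \<exists>W' h. open W' \<and> y \<in> W' \<and> W' \<subseteq> W \<and>
     smooth_on h W' \<and> (\<forall>z\<in>W'. \<psi> z = cover q (h z)))"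

definition smooth_chart :: "(real \<Rightarrow> 'g::topological_space) \<Rightarrow>
    ('g ^ 'v) set \<Rightarrow> ('g ^ 'v \<Rightarrow> real ^ 'v::finite) \<Rightarrow> bool" where
  "smooth_chart q U \<phi> \<longleftrightarrow> open U \<and> open (\<phi> ` U) \<and> inj_on \<phi> U \<and>
     smooth_from q \<phi> U \<and> smooth_into q (inv_into U \<phi>) (\<phi> ` U)"

text \<open>
  The \<open>k\<close>-dimensional slice is the coordinate subspace of \<open>\<real>\<^sup>V\<close> spanned by a
  \<open>k\<close>-element set \<open>K\<close> of coordinates.
\<close>

definition embedded_submanifold ::
    "(real \<Rightarrow> 'g::topological_space) \<Rightarrow> nat \<Rightarrow> ('g ^ 'v::finite) set \<Rightarrow> bool" where
  "embedded_submanifold q k M \<longleftrightarrow> M \<noteq> {} \<and>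
     (\<forall>p\<in>M. \<exists>U \<phi> K. p \<in> U \<and> smooth_chart q U \<phi> \<and> card K = k \<and>
        \<phi> ` (U \<inter> M) = \<phi> ` U \<inter> {y. \<forall>i. i \<notin> K \<longrightarrow> y $ i = 0})"

text \<open>
  The supremum is taken in the extended reals, so that it is \<open>-\<infinity>\<close> if \<open>X\<close> is empty. It is a maximum
  otherwise, because \<open>k \<le> CARD('v)\<close> for every submanifold (\<open>K\<close> is a subset of \<open>'v\<close>).
\<close>

definition dim_an :: "(real \<Rightarrow> 'g::topological_space) \<Rightarrow> ('g ^ 'v::finite) set \<Rightarrow> ereal" where
  "dim_an q X = Sup {ereal (real k) | k. \<exists>M. embedded_submanifold q k M \<and> M \<subseteq> X}"

definition vector_field :: "'v set set \<Rightarrow> ('v set \<Rightarrow> 'g::ab_group_add \<Rightarrow> real) \<Rightarrow>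
    real ^ 'v \<Rightarrow> 'g ^ 'v \<Rightarrow> real ^ 'v::finite" where
  "vector_field E f \<omega> x = (\<chi> v. \<omega> $ v + (\<Sum>w\<in>neighbours E v. f {w, v} (x $ w - x $ v)))"

definition equilibria :: "'v set set \<Rightarrow> ('v set \<Rightarrow> 'g::ab_group_add \<Rightarrow> real) \<Rightarrow>
    real ^ 'v \<Rightarrow> ('g ^ 'v::finite) set" where
  "equilibria E f \<omega> = {x. vector_field E f \<omega> x = 0}"

definition odd_function :: "('g::ab_group_add \<Rightarrow> real) \<Rightarrow> bool" where
  "odd_function h \<longleftrightarrow> (\<forall>x. h (- x) = - h x)"

definition fibres_bounded :: "nat \<Rightarrow> ('g \<Rightarrow> real) \<Rightarrow> bool" where
  "fibres_bounded d h \<longleftrightarrow> (\<forall>y. finite (h -` {y}) \<and> card (h -` {y}) \<le> d)"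

end

theory Submission
  imports Defs
begin

text \<open>
  For a neighbour \<open>w\<close> of \<open>v\<close>, the equilibrium equation at \<open>v\<close> reads
  \<open>f {w, v} (x $ w - x $ v) = c\<close>, where \<open>c\<close> depends only on the coordinates at \<open>v\<close> and at the
  other neighbours of \<open>v\<close>. As \<open>f {w, v}\<close> has finite fibres, finitely many values of those
  coordinates leave finitely many values of \<open>x $ w\<close>. This is the step of zero forcing on graphs:
  if the vertices of \<open>S\<close> force all others, then fixing the coordinates in \<open>S\<close> leaves only finitely
  many equilibria (\<open>finite_forced_coordinate\<close>, \<open>finite_if_finite_coordinates\<close>).

  A forcing set of the required size comes from the induced forest. Choose one leaf of each
  component of \<open>F\<close> as its root, and let \<open>S\<close> consist of the vertices outside \<open>F\<close> and the leaves that
  are not roots. In each tree the knowledge of the coordinates then travels from the leaves to the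
  root, because the parent of a vertex is its only neighbour that is not yet known
  (\<open>forest_forcing_set\<close>). The set \<open>S\<close> has as many elements as the bound says
  (\<open>forcing_set_of_induced_forest\<close>).

  It remains to see that a manifold \<open>M\<close> of equilibria has dimension at most \<open>card S\<close>. A local
  parametrisation of \<open>M\<close>, followed by the projection to the coordinates in \<open>S\<close>, would otherwise
  give fewer \<open>C\<^sup>1\<close> functions than there are parameters, and such functions are simultaneously
  constant on some infinite set (\<open>infinite_common_level_set\<close>); its image in \<open>M\<close> is an infinite set
  of equilibria with the same coordinates in \<open>S\<close>, a contradiction.
\<close>

section \<open>Zero forcing and equilibria\<close>

text \<open>
  The closure of \<open>S\<close> under the colour change rule of zero forcing: a vertex of the closure with at
  most one neighbour \<open>w\<close> outside it puts \<open>w\<close> there too.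
\<close>

inductive_set forced :: "'v set set \<Rightarrow> 'v set \<Rightarrow> 'v set" for E S where
  base: "s \<in> S \<Longrightarrow> s \<in> forced E S"
| force: "v \<in> forced E S \<Longrightarrow> {w, v} \<in> E \<Longrightarrow>
    (\<And>u. u \<in> neighbours E v - {w} \<Longrightarrow> u \<in> forced E S) \<Longrightarrow> w \<in> forced E S"

lemma finite_if_finite_coordinates:
  fixes Y :: "('g ^ 'v::finite) set"
  assumes "\<And>i. finite ((\<lambda>x. x $ i) ` Y)"
  shows "finite Y"
proof -
  have "vec_nth ` Y \<subseteq> (\<Pi>\<^sub>E i\<in>UNIV. (\<lambda>x. x $ i) ` Y)"
    by auto
  moreover have "finite (\<Pi>\<^sub>E i\<in>UNIV. (\<lambda>x. x $ i) ` Y)"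
    using assms by (intro finite_PiE) auto
  ultimately have "finite (vec_nth ` Y)"
    by (rule finite_subset)
  then show ?thesis
    by (rule finite_imageD) (simp add: inj_on_def vec_nth_inject)
qed

text \<open>
  In the forcing step from \<open>v\<close> to \<open>w\<close>, the equation at \<open>v\<close> puts \<open>x $ w - x $ v\<close> into a fibre of
  \<open>f {w, v}\<close> over a value that is determined by the tuple of the coordinates known so far, and there
  are finitely many such tuples.
\<close>

lemma finite_forced_coordinate:
  fixes f :: "'v::finite set \<Rightarrow> 'g::ab_group_add \<Rightarrow> real"
  assumes fibres: "\<And>e y. e \<in> E \<Longrightarrow> finite (f e -` {y})"
    and Y: "Y \<subseteq> equilibria E f \<omega>"
    and S: "\<And>s. s \<in> S \<Longrightarrow> finite ((\<lambda>x. x $ s) ` Y)"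
    and "t \<in> forced E S"
  shows "finite ((\<lambda>x. x $ t) ` Y)"
  using \<open>t \<in> forced E S\<close>
proof induction
  case (base s)
  then show ?case by (rule S)
next
  case (force v w)
  define N where "N = neighbours E v - {w}"
  define rest where "rest x = restrict (vec_nth x) (insert v N)" for x :: "'g ^ 'v"
  \<comment> \<open>the value that the coupling along \<open>{w, v}\<close> must take when the known coordinates are \<open>c\<close>\<close>
  define val where "val c = - \<omega> $ v - (\<Sum>u\<in>N. f {u, v} (c u - c v))" for c
  have "rest ` Y \<subseteq> (\<Pi>\<^sub>E i\<in>insert v N. (\<lambda>x. x $ i) ` Y)"
    by (intro image_subsetI PiE_I) (auto simp: rest_def)
  moreover have "finite (\<Pi>\<^sub>E i\<in>insert v N. (\<lambda>x. x $ i) ` Y)"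
    using force by (intro finite_PiE) (auto simp: N_def)
  ultimately have fin: "finite (rest ` Y)"
    by (rule finite_subset)
  have "x $ w \<in> (\<Union>c\<in>rest ` Y. (\<lambda>z. z + c v) ` (f {w, v} -` {val c}))" if "x \<in> Y" for x
  proof -
    have w: "w \<in> neighbours E v" using force by (simp add: neighbours_def)
    have "vector_field E f \<omega> x $ v = 0"
      using Y \<open>x \<in> Y\<close> by (auto simp: equilibria_def)
    then have "\<omega> $ v + (f {w, v} (x $ w - x $ v) + (\<Sum>u\<in>N. f {u, v} (x $ u - x $ v))) = 0"
      by (simp add: vector_field_def N_def sum.remove[OF _ w])
    moreover have "(\<Sum>u\<in>N. f {u, v} (rest x u - rest x v)) = (\<Sum>u\<in>N. f {u, v} (x $ u - x $ v))"
      by (rule sum.cong) (auto simp: rest_def)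
    ultimately have "f {w, v} (x $ w - x $ v) = val (rest x)"
      unfolding val_def by linarith
    then have "x $ w \<in> (\<lambda>z. z + rest x v) ` (f {w, v} -` {val (rest x)})"
      by (intro image_eqI[of _ _ "x $ w - x $ v"]) (auto simp: rest_def)
    then show ?thesis using that by blast
  qed
  moreover have "finite (\<Union>c\<in>rest ` Y. (\<lambda>z. z + c v) ` (f {w, v} -` {val c}))"
    using fin fibres force by blast
  ultimately show ?case
    by (meson finite_subset image_subsetI)
qed

section \<open>Forcing sets from induced forests\<close>

definition simple_path :: "'v set set \<Rightarrow> 'v list \<Rightarrow> bool" where
  "simple_path D xs \<longleftrightarrow> xs \<noteq> [] \<and> distinct xs \<and> successively (\<lambda>a b. {a, b} \<in> D) xs"

abbreviation reaches :: "'v set set \<Rightarrow> ('v \<times> 'v) set" where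
  "reaches D \<equiv> {(a, b). {a, b} \<in> D}\<^sup>*"

lemma simple_path_single: "simple_path D [v]"
  by (simp add: simple_path_def)

lemma simple_path_snoc:
  "simple_path D xs \<Longrightarrow> {last xs, u} \<in> D \<Longrightarrow> u \<notin> set xs \<Longrightarrow> simple_path D (xs @ [u])"
  by (simp add: simple_path_def successively_append_iff)

lemma simple_path_reaches:
  assumes "simple_path D xs"
  shows "(hd xs, last xs) \<in> reaches D"
proof -
  have "xs \<noteq> []" "successively (\<lambda>a b. {a, b} \<in> D) xs"
    using assms by (auto simp: simple_path_def)
  then show ?thesis
    by (induction xs rule: induct_list012) (auto intro: converse_rtrancl_into_rtrancl)
qed

lemma sym_reaches: "sym (reaches D)"
  by (intro sym_rtrancl) (auto simp: sym_def insert_commute)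

text \<open>
  A path in a finite graph cannot be prolonged for ever. The arguments about forests below all end
  this way, each with its own invariant \<open>P\<close>.
\<close>

lemma no_endless_extension:
  fixes P :: "'v::finite list \<Rightarrow> bool"
  assumes "P xs" and "\<And>xs. P xs \<Longrightarrow> distinct xs"
    and "\<And>xs. P xs \<Longrightarrow> \<exists>ys. ys \<noteq> [] \<and> P (xs @ ys)"
  shows False
proof -
  have "\<exists>xs. P xs \<and> n \<le> length xs" for n
  proof (induction n)
    case 0
    then show ?case using assms(1) by auto
  next
    case (Suc n)
    then obtain xs ys where "n \<le> length xs" "ys \<noteq> []" "P (xs @ ys)"
      using assms(3) by blast
    then show ?case
      by (intro exI[of _ "xs @ ys"]) (use \<open>n \<le> length xs\<close> in \<open>cases ys; simp\<close>)
  qed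
  then obtain xs where xs: "P xs" "Suc CARD('v) \<le> length xs" by blast
  have "length xs = card (set xs)"
    using assms(2)[OF xs(1)] by (simp add: distinct_card)
  also have "\<dots> \<le> CARD('v)" by (intro card_mono) auto
  finally show False using xs(2) by simp
qed

text \<open>
  Any other neighbour of the last vertex on the path would close a cycle with the part of the path
  that follows it.
\<close>

lemma forest_neighbour_of_path_end:
  assumes "is_forest F D" "simple_path D xs" "{last xs, u} \<in> D" "u \<in> set xs"
  shows "\<exists>ys. xs = ys @ [u, last xs]"
proof -
  obtain ys zs where xs: "xs = ys @ u # zs"
    using \<open>u \<in> set xs\<close> by (meson split_list)
  have "u \<noteq> last xs"
    using assms(1,3) by (force simp: is_forest_def is_graph_def)
  then have "zs \<noteq> []" using xs by auto
  then have lz: "last xs = last zs" using xs by simp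
  have "length zs < 2"
  proof (rule ccontr)
    assume "\<not> length zs < 2"
    moreover have "distinct (u # zs)" "successively (\<lambda>a b. {a, b} \<in> D) (u # zs)"
      using assms(2) xs by (auto simp: simple_path_def successively_append_iff)
    moreover have "{(u # zs) ! i, (u # zs) ! (Suc i mod length (u # zs))} \<in> D"
      if "i < length (u # zs)" for i
    proof (cases "Suc i < length (u # zs)")
      case True
      then show ?thesis
        using \<open>successively _ (u # zs)\<close> by (simp add: successively_conv_nth)
    next
      case False
      then have "Suc i = length (u # zs)" using that by simp
      then show ?thesis
        using assms(3) lz \<open>zs \<noteq> []\<close> by (auto simp: last_conv_nth nth_Cons split: nat.splits)
    qed
    ultimately have "is_cycle D (u # zs)"
      unfolding is_cycle_def by auto
    then show False using assms(1) by (auto simp: is_forest_def)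
  qed
  then have "zs = [last xs]"
    using \<open>zs \<noteq> []\<close> lz by (cases zs) auto
  then show ?thesis using xs by auto
qed

text \<open>
  One of the neighbours may be the vertex before the last one; a path with a single vertex has no
  such vertex, so there any neighbour will do.
\<close>

lemma forest_path_extension:
  fixes D :: "'v::finite set set"
  assumes "is_forest F D" "simple_path D xs"
    and "2 \<le> card (neighbours D (last xs)) \<or> length xs = 1 \<and> neighbours D (last xs) \<noteq> {}"
  shows "\<exists>u. {last xs, u} \<in> D \<and> u \<notin> set xs"
proof (rule ccontr)
  assume no_ext: "\<not> ?thesis"
  have previous: "2 \<le> length xs \<and> u = last (butlast xs)" if u: "u \<in> neighbours D (last xs)" for u
  proof -
    have edge: "{last xs, u} \<in> D"
      using u by (simp add: neighbours_def insert_commute)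
    then have "u \<in> set xs" using no_ext by blast
    then obtain ys where "xs = ys @ [u, last xs]"
      using forest_neighbour_of_path_end[OF assms(1,2) edge] by blast
    then obtain x where "xs = (ys @ [u]) @ [x]" by simp
    then show ?thesis by (simp add: butlast_append)
  qed
  then have "neighbours D (last xs) \<subseteq> {last (butlast xs)}" by blast
  then have "card (neighbours D (last xs)) \<le> 1"
    using card_mono[of "{last (butlast xs)}"] by simp
  then have "length xs = 1" "neighbours D (last xs) \<noteq> {}"
    using assms(3) by auto
  then show False using previous by force
qed

text \<open>
  A path from \<open>v\<close> whose end is not a leaf can be continued, since its end then has a neighbour
  besides the vertex before it.
\<close>

lemma reachable_leaf:
  fixes F :: "'v::finite set"
  assumes forest: "is_forest F D" and noiso: "isolated_vertices F D = {}" and "v \<in> F"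
  shows "\<exists>w\<in>leaves F D. (v, w) \<in> reaches D"
proof (rule ccontr)
  assume none: "\<not> ?thesis"
  have closed: "b \<in> F" if "(a, b) \<in> reaches D" "a \<in> F" for a b
    using that forest by (induction rule: rtrancl_induct) (auto simp: is_forest_def is_graph_def)
  show False
  proof (rule no_endless_extension[where P = "\<lambda>xs. simple_path D xs \<and> hd xs = v"])
    show "simple_path D [v] \<and> hd [v] = v" by (simp add: simple_path_single)
  next
    fix xs assume P: "simple_path D xs \<and> hd xs = v"
    then show "distinct xs" by (simp add: simple_path_def)
    have "(v, last xs) \<in> reaches D" using P simple_path_reaches by blast
    then have "last xs \<in> F" "last xs \<notin> leaves F D" using closed \<open>v \<in> F\<close> none by blast+
    moreover have "last xs \<notin> isolated_vertices F D" using noiso by simp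
    ultimately have "card (neighbours D (last xs)) \<noteq> 0" "card (neighbours D (last xs)) \<noteq> 1"
      by (auto simp: leaves_def isolated_vertices_def)
    then have "2 \<le> card (neighbours D (last xs))" by linarith
    then obtain u where "{last xs, u} \<in> D" "u \<notin> set xs"
      using forest_path_extension[OF forest, of xs] P by blast
    then have "simple_path D (xs @ [u])" using P by (simp add: simple_path_snoc)
    moreover have "hd (xs @ [u]) = v" using P by (simp add: simple_path_def)
    ultimately show "\<exists>ys. ys \<noteq> [] \<and> simple_path D (xs @ ys) \<and> hd (xs @ ys) = v"
      by blast
  qed
qed

text \<open>
  The roots represent the components, so that removing them from the leaves accounts for the
  number of components in the bound.
\<close>

lemma root_leaves:
  fixes F :: "'v::finite set"
  assumes forest: "is_forest F D" and noiso: "isolated_vertices F D = {}"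
  shows "\<exists>R \<subseteq> leaves F D. card R = card (connected_components F D) \<and>
    (\<forall>r\<in>R. \<forall>r'\<in>R. (r, r') \<in> reaches D \<longrightarrow> r = r')"
proof -
  define A where "A = {(u, w). u \<in> F \<and> w \<in> F \<and> (u, w) \<in> reaches D}"
  have cc: "connected_components F D = F // A"
    by (simp add: connected_components_def A_def)
  have eqv: "equiv F A"
    unfolding equiv_def A_def using sym_reaches[of D]
    by (auto simp: refl_on_def sym_def trans_def intro: rtrancl_trans)
  have "\<exists>w. w \<in> C \<and> w \<in> leaves F D" if C: "C \<in> F // A" for C
  proof -
    obtain v where v: "v \<in> F" "C = A `` {v}" using quotientE[OF C] by metis
    then obtain w where "w \<in> leaves F D" "(v, w) \<in> reaches D"
      using reachable_leaf[OF forest noiso] by blast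
    with v show ?thesis by (auto simp: A_def leaves_def)
  qed
  then obtain \<rho> where \<rho>: "\<And>C. C \<in> F // A \<Longrightarrow> \<rho> C \<in> C \<and> \<rho> C \<in> leaves F D"
    by metis
  have same: "C = C'" if "C \<in> F // A" "C' \<in> F // A" "(\<rho> C, \<rho> C') \<in> A" for C C'
    using quotient_eqI[OF eqv that(1,2)] \<rho> that by blast
  have inj: "inj_on \<rho> (F // A)"
  proof (rule inj_onI)
    fix C C' assume C: "C \<in> F // A" "C' \<in> F // A" "\<rho> C = \<rho> C'"
    then have "\<rho> C \<in> F" using \<rho> by (auto simp: leaves_def)
    then show "C = C'" using C by (intro same) (auto simp: A_def)
  qed
  show ?thesis
  proof (intro exI conjI ballI impI)
    show "\<rho> ` (F // A) \<subseteq> leaves F D" using \<rho> by blast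
    show "card (\<rho> ` (F // A)) = card (connected_components F D)"
      using inj by (simp add: card_image cc)
    fix r r' assume r: "r \<in> \<rho> ` (F // A)" "r' \<in> \<rho> ` (F // A)" "(r, r') \<in> reaches D"
    then have "(r, r') \<in> A" using \<rho> by (auto simp: A_def leaves_def)
    then show "r = r'" using r same by blast
  qed
qed

text \<open>
  Suppose that some vertex is not forced. Consider a path in the forest that ends in an unforced
  vertex \<open>v\<close>. Unless \<open>v\<close> is a dead end, it has a neighbour \<open>u\<close> off the path. If \<open>u\<close> is forced, it has an unforced neighbour other than \<open>v\<close>, for otherwise it would force \<open>v\<close>; so the path
  can be continued to an unforced vertex in one step or in two, which cannot go on for ever. Only
  a root can be an unforced dead end, because the other leaves are in the forcing set. The path
  therefore starts at an unforced root if there is one: it then meets no other root, as no two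
  roots are connected.
\<close>

lemma forest_forcing_set:
  fixes E :: "'v::finite set set"
  assumes forest: "is_forest F (induced_edges E F)"
    and noiso: "isolated_vertices F (induced_edges E F) = {}"
    and R: "R \<subseteq> leaves F (induced_edges E F)"
    and sep: "\<And>r r'. r \<in> R \<Longrightarrow> r' \<in> R \<Longrightarrow> (r, r') \<in> reaches (induced_edges E F) \<Longrightarrow> r = r'"
  shows "forced E (- F \<union> (leaves F (induced_edges E F) - R)) = UNIV"
proof (rule ccontr)
  define D where "D = induced_edges E F"
  define T where "T = forced E (- F \<union> (leaves F D - R))"
  assume "forced E (- F \<union> (leaves F (induced_edges E F) - R)) \<noteq> UNIV"
  \<comment> \<open>an unforced root if there is one, any unforced vertex otherwise\<close>
  then obtain s where s: "s \<notin> T" "s \<in> R \<or> R \<subseteq> T"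
    unfolding T_def D_def by blast
  have unforced: "v \<in> F \<and> (v \<in> R \<or> v \<notin> leaves F D)" if "v \<notin> T" for v
  proof (rule ccontr)
    assume "\<not> ?thesis"
    then have "v \<in> - F \<union> (leaves F D - R)" by blast
    with that show False unfolding T_def by (blast intro: forced.base)
  qed
  show False
  proof (rule no_endless_extension[where P = "\<lambda>xs. simple_path D xs \<and> hd xs = s \<and> last xs \<notin> T"])
    show "simple_path D [s] \<and> hd [s] = s \<and> last [s] \<notin> T"
      using s by (simp add: simple_path_single)
  next
    fix xs assume P: "simple_path D xs \<and> hd xs = s \<and> last xs \<notin> T"
    then show "distinct xs" by (simp add: simple_path_def)
    define v where "v = last xs"
    have v: "v \<notin> T" "v \<in> F" "v \<in> R \<or> v \<notin> leaves F D"
      using P unforced by (auto simp: v_def)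
    have deg: "card (neighbours D v) \<noteq> 0"
      using noiso v(2) by (auto simp: isolated_vertices_def D_def)
    have "2 \<le> card (neighbours D v) \<or> length xs = 1 \<and> neighbours D v \<noteq> {}"
    proof (cases "v \<in> R")
      case True
      then have "s \<in> R" using s(2) v(1) by blast
      have "(s, v) \<in> reaches D" using P simple_path_reaches v_def by blast
      then have "hd xs = last xs"
        using sep \<open>s \<in> R\<close> True P by (simp add: D_def v_def)
      then have "length xs = 1"
        using P by (cases xs) (auto simp: simple_path_def split: if_splits)
      then show ?thesis using deg by auto
    next
      case False
      then have "card (neighbours D v) \<noteq> 1" using v by (auto simp: leaves_def)
      then show ?thesis using deg by linarith
    qed
    then obtain u where u: "{v, u} \<in> D" "u \<notin> set xs"
      using forest_path_extension[of F D xs] forest P unfolding D_def v_def by blast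
    then have path: "simple_path D (xs @ [u])"
      using P by (simp add: simple_path_snoc v_def)
    show "\<exists>ys. ys \<noteq> [] \<and> simple_path D (xs @ ys) \<and> hd (xs @ ys) = s \<and> last (xs @ ys) \<notin> T"
    proof (cases "u \<in> T")
      case False
      then show ?thesis
        using path P by (intro exI[of _ "[u]"]) (simp add: simple_path_def)
    next
      case True
      have "{v, u} \<in> E" using u by (simp add: D_def induced_edges_def)
      then obtain u' where u': "{u', u} \<in> E" "u' \<noteq> v" "u' \<notin> T"
        using forced.force[of u E _ v] True v(1) unfolding T_def neighbours_def by blast
      then have edge: "{u, u'} \<in> D"
        using unforced[OF u'(3)] u(1) by (auto simp: D_def induced_edges_def insert_commute)
      have "u' \<notin> set (xs @ [u])"
      proof
        assume "u' \<in> set (xs @ [u])"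
        then obtain ys where "xs @ [u] = ys @ [u', u]"
          using forest_neighbour_of_path_end[of F D "xs @ [u]" u'] forest path edge
          by (auto simp: D_def)
        then have "xs = ys @ [u']" by simp
        then show False using u'(2) by (simp add: v_def)
      qed
      then have "simple_path D ((xs @ [u]) @ [u'])"
        using simple_path_snoc[OF path] edge by simp
      then have "simple_path D (xs @ [u, u'])" by simp
      moreover have "hd (xs @ [u, u']) = s" using P by (simp add: simple_path_def)
      ultimately show ?thesis
        using u'(3) by (intro exI[of _ "[u, u']"]) simp
    qed
  qed
qed

lemma forcing_set_of_induced_forest:
  fixes E :: "'v::finite set set"
  assumes forest: "is_forest F (induced_edges E F)"
    and noiso: "isolated_vertices F (induced_edges E F) = {}"
  obtains S where "forced E S = UNIV"
    "real (card S) = real CARD('v) - real (card F)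
       + real (card (leaves F (induced_edges E F)))
       - real (card (connected_components F (induced_edges E F)))"
proof -
  define L where "L = leaves F (induced_edges E F)"
  obtain R where R: "R \<subseteq> L" "card R = card (connected_components F (induced_edges E F))"
    "\<forall>r\<in>R. \<forall>r'\<in>R. (r, r') \<in> reaches (induced_edges E F) \<longrightarrow> r = r'"
    using root_leaves[OF forest noiso] unfolding L_def by blast
  have "L \<subseteq> F" by (auto simp: L_def leaves_def)
  then have "card (- F \<union> (L - R)) = card (- F) + card (L - R)"
    by (intro card_Un_disjoint) auto
  also have "\<dots> = (CARD('v) - card F) + (card L - card R)"
    using R(1) by (simp add: Compl_eq_Diff_UNIV card_Diff_subset)
  finally have "real (card (- F \<union> (L - R))) = real CARD('v) - real (card F) + real (card L) - real (card R)"
    using card_mono[OF finite, of R L] card_mono[of UNIV F] R(1) by (simp add: of_nat_diff)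
  then show thesis
    using forest_forcing_set[OF forest noiso, of R] R that unfolding L_def by simp
qed

section \<open>Common level sets of few functions\<close>

text \<open>
  By the inverse function theorem, \<open>g\<close> can replace the \<open>j\<close>-th coordinate near \<open>p\<close> while the other
  coordinates stay as they are; \<open>\<Psi>\<close> is the inverse of this change of coordinates. The explicit
  derivative of \<open>\<Psi>\<close> shows that composition with \<open>\<Psi>\<close> keeps functions continuously differentiable.
\<close>

lemma straighten_coordinate:
  fixes g :: "'a::euclidean_space \<Rightarrow> real"
  assumes "open W" "p \<in> W" "j \<in> Basis"
    and der: "\<And>x. x \<in> W \<Longrightarrow> (g has_derivative g' x) (at x)"
    and cont: "\<And>v. continuous_on W (\<lambda>x. g' x v)"
    and "g' p j \<noteq> 0"
  obtains B \<Psi> q where "open B" "q \<in> B" "\<Psi> q = p" "\<Psi> ` B \<subseteq> W" "inj_on \<Psi> B"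
    "\<And>z. z \<in> B \<Longrightarrow> g (\<Psi> z) = z \<bullet> j"
    "\<And>z i. z \<in> B \<Longrightarrow> i \<in> Basis - {j} \<Longrightarrow> \<Psi> z \<bullet> i = z \<bullet> i"
    "\<And>z. z \<in> B \<Longrightarrow> g' (\<Psi> z) j \<noteq> 0"
    "\<And>z. z \<in> B \<Longrightarrow>
      (\<Psi> has_derivative (\<lambda>w. w + ((w \<bullet> j - g' (\<Psi> z) w) / g' (\<Psi> z) j) *\<^sub>R j)) (at z)"
proof -
  define W0 where "W0 = {x \<in> W. g' x j \<noteq> 0}"
  define \<Phi> where "\<Phi> y = y + (g y - y \<bullet> j) *\<^sub>R j" for y
  \<comment> \<open>the derivative of \<open>\<Phi>\<close> at \<open>y\<close> and its inverse\<close>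
  define L where "L y v = v + (g' y v - v \<bullet> j) *\<^sub>R j" for y v
  define M where "M y w = w + ((w \<bullet> j - g' y w) / g' y j) *\<^sub>R j" for y w
  have jj: "j \<bullet> j = 1"
    using \<open>j \<in> Basis\<close> by simp
  have "W0 = W \<inter> (\<lambda>x. g' x j) -` (- {0})"
    by (auto simp: W0_def)
  then have "open W0"
    using continuous_open_preimage[OF cont \<open>open W\<close>, of "- {0}" j] by auto
  have "W0 \<subseteq> W" "p \<in> W0"
    using assms by (auto simp: W0_def)
  have lin: "bounded_linear (g' y)" if "y \<in> W0" for y
    using der \<open>W0 \<subseteq> W\<close> that has_derivative_bounded_linear by blast
  have blL: "bounded_linear (L y)" if "y \<in> W0" for y
    unfolding L_def
    by (intro bounded_linear_add bounded_linear_ident bounded_linear_scaleR_const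
        bounded_linear_sub lin that bounded_linear_inner_left)
  have blM: "bounded_linear (M y)" if "y \<in> W0" for y
    unfolding M_def divide_inverse
    by (intro bounded_linear_add bounded_linear_ident bounded_linear_scaleR_const
        bounded_linear_mult_const bounded_linear_sub lin that bounded_linear_inner_left)
  have left_inv: "M y (L y v) = v" and right_inv: "L y (M y v) = v" if "y \<in> W0" for y v
  proof -
    interpret bounded_linear "g' y" by (rule lin[OF that])
    have nz: "g' y j \<noteq> 0" using that by (simp add: W0_def)
    have "L y v \<bullet> j = g' y v" "g' y (L y v) = g' y v + (g' y v - v \<bullet> j) * g' y j"
      by (simp_all add: L_def add scaleR inner_add_left jj)
    then have "(L y v \<bullet> j - g' y (L y v)) / g' y j = - (g' y v - v \<bullet> j)"
      using nz by (simp add: field_simps)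
    then show "M y (L y v) = v"
      unfolding M_def by (simp only: scaleR_minus_left) (simp add: L_def)
    have "M y v \<bullet> j = v \<bullet> j + (v \<bullet> j - g' y v) / g' y j" "g' y (M y v) = v \<bullet> j"
      using nz by (simp_all add: M_def add scaleR inner_add_left jj)
    then have "g' y (M y v) - M y v \<bullet> j = - ((v \<bullet> j - g' y v) / g' y j)"
      by simp
    then show "L y (M y v) = v"
      unfolding L_def by (simp only: scaleR_minus_left) (simp add: M_def)
  qed
  have derPhi: "(\<Phi> has_derivative L y) (at y)" if "y \<in> W0" for y
    unfolding \<Phi>_def L_def
    using der[of y] that \<open>W0 \<subseteq> W\<close> by (auto intro!: derivative_eq_intros)
  have contL: "continuous_on W0 (\<lambda>y. Blinfun (L y))"
  proof (rule continuous_on_blinfun_componentwise)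
    fix i :: 'a
    have "continuous_on W0 (\<lambda>y. L y i)"
      unfolding L_def using cont \<open>W0 \<subseteq> W\<close>
      by (intro continuous_intros) (auto intro: continuous_on_subset)
    then show "continuous_on W0 (\<lambda>y. blinfun_apply (Blinfun (L y)) i)"
      by (simp add: bounded_linear_Blinfun_apply blL cong: continuous_on_cong)
  qed
  have inv: "Blinfun (M p) o\<^sub>L Blinfun (L p) = id_blinfun"
    by (rule blinfun_eqI) (simp add: bounded_linear_Blinfun_apply blL blM \<open>p \<in> W0\<close> left_inv)
  obtain A B \<Psi> \<Psi>' where IFT: "open A" "A \<subseteq> W0" "p \<in> A" "open B" "\<Phi> p \<in> B" "homeomorphism A B \<Phi> \<Psi>"
    "\<And>y. y \<in> B \<Longrightarrow> (\<Psi> has_derivative \<Psi>' y) (at y)"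
    "\<And>y. y \<in> B \<Longrightarrow> \<Psi>' y = inv (blinfun_apply (Blinfun (L (\<Psi> y))))"
    by (rule inverse_function_theorem[OF \<open>open W0\<close> _ contL \<open>p \<in> W0\<close> inv, of \<Phi>])
       (auto simp: bounded_linear_Blinfun_apply blL derPhi)
  have \<Psi>B: "\<Psi> z \<in> W0" if "z \<in> B" for z
    using that IFT(2,6) by (force simp: homeomorphism_def)
  have \<Phi>\<Psi>: "\<Phi> (\<Psi> z) = z" if "z \<in> B" for z
    using that IFT(6) by (simp add: homeomorphism_def)
  show thesis
  proof
    show "open B" "\<Phi> p \<in> B" by fact+
    show "\<Psi> (\<Phi> p) = p"
      using IFT(3,6) by (simp add: homeomorphism_def)
    show "\<Psi> ` B \<subseteq> W" using \<Psi>B \<open>W0 \<subseteq> W\<close> by auto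
    show "inj_on \<Psi> B" using \<Phi>\<Psi> by (metis inj_onI)
    fix z assume z: "z \<in> B"
    have "\<Phi> (\<Psi> z) \<bullet> j = z \<bullet> j" using \<Phi>\<Psi>[OF z] by simp
    then show "g (\<Psi> z) = z \<bullet> j"
      by (simp add: \<Phi>_def inner_add_left jj)
    show "g' (\<Psi> z) j \<noteq> 0" using \<Psi>B[OF z] by (simp add: W0_def)
    have "inv (L (\<Psi> z)) = M (\<Psi> z)"
      using left_inv right_inv \<Psi>B[OF z] by (intro inv_equality) auto
    then have "\<Psi>' z = M (\<Psi> z)"
      using IFT(8)[OF z] by (simp add: bounded_linear_Blinfun_apply blL \<Psi>B z)
    then show "(\<Psi> has_derivative (\<lambda>w. w + ((w \<bullet> j - g' (\<Psi> z) w) / g' (\<Psi> z) j) *\<^sub>R j)) (at z)"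
      using IFT(7)[OF z] by (simp add: M_def[abs_def])
    fix i assume i: "i \<in> Basis - {j}"
    have "\<Phi> (\<Psi> z) \<bullet> i = \<Psi> z \<bullet> i"
      using i \<open>j \<in> Basis\<close> by (auto simp: \<Phi>_def inner_add_left inner_not_same_Basis)
    then show "\<Psi> z \<bullet> i = z \<bullet> i" using \<Phi>\<Psi>[OF z] by simp
  qed
qed

lemma constant_on_slice:
  fixes g :: "'a::euclidean_space \<Rightarrow> real"
  assumes der: "\<And>x. x \<in> ball p e \<Longrightarrow> (g has_derivative g' x) (at x)"
    and flat: "\<And>x j. x \<in> ball p e \<Longrightarrow> \<forall>i\<in>Basis - K. x \<bullet> i = p \<bullet> i \<Longrightarrow> j \<in> K \<Longrightarrow> g' x j = 0"
    and "K \<subseteq> Basis"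
    and x: "x \<in> ball p e" "\<forall>i\<in>Basis - K. x \<bullet> i = p \<bullet> i"
  shows "g x = g p"
proof -
  define u where "u = x - p"
  have u: "u \<bullet> i = 0" if "i \<in> Basis - K" for i
    using x that by (simp add: u_def inner_diff_left)
  have "((\<lambda>t. g (p + t *\<^sub>R u)) has_derivative (\<lambda>h. 0)) (at t within {0..1})" if t: "t \<in> {0..1}" for t :: real
  proof -
    have "norm (t *\<^sub>R u) \<le> norm u"
      using t by (simp add: mult_left_le_one_le)
    moreover have "norm u < e"
      using x by (simp add: u_def dist_norm norm_minus_commute)
    ultimately have mem: "p + t *\<^sub>R u \<in> ball p e"
      by (simp add: dist_norm)
    have slice: "\<forall>i\<in>Basis - K. (p + t *\<^sub>R u) \<bullet> i = p \<bullet> i"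
      using u by (simp add: inner_add_left)
    interpret bounded_linear "g' (p + t *\<^sub>R u)"
      using der[OF mem] has_derivative_bounded_linear by blast
    have "g' (p + t *\<^sub>R u) u = g' (p + t *\<^sub>R u) (\<Sum>i\<in>Basis. (u \<bullet> i) *\<^sub>R i)"
      by (simp add: euclidean_representation)
    also have "\<dots> = (\<Sum>i\<in>Basis. (u \<bullet> i) * g' (p + t *\<^sub>R u) i)"
      by (simp add: sum scaleR)
    also have "\<dots> = 0"
      using u flat[OF mem slice] by (intro sum.neutral) (metis DiffI mult_eq_0_iff)
    finally have z: "g' (p + t *\<^sub>R u) u = 0" .
    have "((\<lambda>t. p + t *\<^sub>R u) has_derivative (\<lambda>h. h *\<^sub>R u)) (at t within {0..1})"
      by (auto intro!: derivative_eq_intros)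
    from has_derivative_compose[OF this der[OF mem]] show ?thesis
      by (simp add: scaleR z)
  qed
  then obtain c where "\<forall>t\<in>{0..1}. g (p + t *\<^sub>R u) = c"
    using has_derivative_zero_constant[of "{0..1::real}" "\<lambda>t. g (p + t *\<^sub>R u)"] by auto
  from bspec[OF this, of 0] bspec[OF this, of 1] show ?thesis
    by (simp add: u_def)
qed

text \<open>
  The slice through \<open>p\<close> in the directions of \<open>K\<close> has more dimensions than there are functions. This
  elementary substitute for the constant rank theorem is proved by induction on the number of
  functions. If the derivative of \<open>G s\<close> vanishes along the slice, \<open>G s\<close> is constant on the
  slice near \<open>p\<close> and can be dropped. Otherwise \<open>G s\<close> becomes a coordinate \<open>j\<close> after a change of coordinates that preserves
  the slice, and the other functions are restricted to a hyperplane on which this coordinate is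
  constant: one function and one dimension are lost together.
\<close>

lemma infinite_common_level_set:
  fixes G :: "'s \<Rightarrow> 'a::euclidean_space \<Rightarrow> real"
  assumes "finite S" "card S < card K" "K \<subseteq> Basis" "open W" "p \<in> W"
    and "\<And>s x. s \<in> S \<Longrightarrow> x \<in> W \<Longrightarrow> (G s has_derivative G' s x) (at x)"
    and "\<And>s v. s \<in> S \<Longrightarrow> continuous_on W (\<lambda>x. G' s x v)"
  shows "\<exists>Z\<subseteq>W. infinite Z \<and> (\<forall>z\<in>Z. \<forall>i\<in>Basis - K. z \<bullet> i = p \<bullet> i) \<and>
    (\<forall>s\<in>S. \<forall>z\<in>Z. \<forall>z'\<in>Z. G s z = G s z')"
  using assms
proof (induction S arbitrary: K W p G G' rule: finite_induct)
  case empty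
  then obtain j where j: "j \<in> K" "j \<in> Basis"
    by (metis card.empty ex_in_conv less_irrefl subsetD)
  obtain e where e: "e > 0" "ball p e \<subseteq> W"
    using empty open_contains_ball by blast
  define Z where "Z = (\<lambda>t. p + t *\<^sub>R j) ` {0<..<e}"
  have "inj_on (\<lambda>t. p + t *\<^sub>R j) {0<..<e}"
    using j by (intro inj_onI) auto
  then have "infinite Z"
    unfolding Z_def using e by (simp add: finite_image_iff infinite_Ioo)
  moreover have "Z \<subseteq> W"
    using e j by (force simp: Z_def dist_norm)
  moreover have "\<forall>z\<in>Z. \<forall>i\<in>Basis - K. z \<bullet> i = p \<bullet> i"
    using j by (auto simp: Z_def inner_add_left inner_Basis)
  ultimately show ?case by auto
next
  case (insert s S)
  note der = insert.prems(5) and cont = insert.prems(6)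
  have finK: "finite K" using insert.prems(2) finite_Basis finite_subset by blast
  show ?case
  proof (cases "\<exists>x\<in>W. \<exists>j\<in>K. (\<forall>i\<in>Basis - K. x \<bullet> i = p \<bullet> i) \<and> G' s x j \<noteq> 0")
    case False
    obtain e where e: "e > 0" "ball p e \<subseteq> W"
      using insert.prems open_contains_ball by blast
    have "\<exists>Z\<subseteq>ball p e. infinite Z \<and> (\<forall>z\<in>Z. \<forall>i\<in>Basis - K. z \<bullet> i = p \<bullet> i) \<and>
        (\<forall>t\<in>S. \<forall>z\<in>Z. \<forall>z'\<in>Z. G t z = G t z')"
    proof (rule insert.IH[where G' = G'])
      show "card S < card K" using insert.prems(1) insert.hyps by simp
      show "continuous_on (ball p e) (\<lambda>x. G' t x v)" if "t \<in> S" for t v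
        using continuous_on_subset[OF cont e(2)] that by blast
      show "(G t has_derivative G' t x) (at x)" if "t \<in> S" "x \<in> ball p e" for t x
        using der e(2) that by blast
    qed (use insert.prems e in auto)
    then obtain Z where Z: "Z \<subseteq> ball p e" "infinite Z" "\<forall>z\<in>Z. \<forall>i\<in>Basis - K. z \<bullet> i = p \<bullet> i"
      "\<forall>t\<in>S. \<forall>z\<in>Z. \<forall>z'\<in>Z. G t z = G t z'"
      by blast
    have gs: "G s z = G s p" if "z \<in> Z" for z
      using that Z(1,3) False e insert.prems
      by (intro constant_on_slice[where e = e and K = K and g' = "G' s"]) blast+
    have "G t z = G t z'" if "t \<in> insert s S" "z \<in> Z" "z' \<in> Z" for t z z'
    proof (cases "t = s")
      case True
      with gs[OF that(2)] gs[OF that(3)] show ?thesis by simp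
    qed (use that Z(4) in blast)
    moreover have "Z \<subseteq> W" using Z(1) e(2) by (rule subset_trans)
    ultimately show ?thesis using Z(2,3) by blast
  next
    case True
    then obtain x j where x: "x \<in> W" "j \<in> K" "\<forall>i\<in>Basis - K. x \<bullet> i = p \<bullet> i" "G' s x j \<noteq> 0"
      by blast
    then have "j \<in> Basis" using insert.prems by blast
    obtain B \<Psi> q where B: "open B" "q \<in> B" "\<Psi> q = x" "\<Psi> ` B \<subseteq> W" "inj_on \<Psi> B"
      and g\<Psi>: "\<And>z. z \<in> B \<Longrightarrow> G s (\<Psi> z) = z \<bullet> j"
      and coord: "\<And>z i. z \<in> B \<Longrightarrow> i \<in> Basis - {j} \<Longrightarrow> \<Psi> z \<bullet> i = z \<bullet> i"
      and nz: "\<And>z. z \<in> B \<Longrightarrow> G' s (\<Psi> z) j \<noteq> 0"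
      and der\<Psi>: "\<And>z. z \<in> B \<Longrightarrow>
        (\<Psi> has_derivative (\<lambda>w. w + ((w \<bullet> j - G' s (\<Psi> z) w) / G' s (\<Psi> z) j) *\<^sub>R j)) (at z)"
      by (rule straighten_coordinate[OF \<open>open W\<close> \<open>x \<in> W\<close> \<open>j \<in> Basis\<close> der[OF insertI1]
            cont[OF insertI1] x(4)]) blast+
    \<comment> \<open>the derivative of \<open>G t \<circ> \<Psi>\<close> by the chain rule\<close>
    define H' where "H' t z w = G' t (\<Psi> z) w + ((w \<bullet> j - G' s (\<Psi> z) w) / G' s (\<Psi> z) j) * G' t (\<Psi> z) j"
      for t z w
    have "continuous_on B \<Psi>"
      using der\<Psi> has_derivative_continuous continuous_at_imp_continuous_on by blast
    then have contG: "continuous_on B (\<lambda>z. G' t (\<Psi> z) w)" if "t \<in> insert s S" for t w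
      using continuous_on_compose2[OF cont[OF that] _ B(4)] by blast
    have "\<exists>Z\<subseteq>B. infinite Z \<and> (\<forall>z\<in>Z. \<forall>i\<in>Basis - (K - {j}). z \<bullet> i = q \<bullet> i) \<and>
        (\<forall>t\<in>S. \<forall>z\<in>Z. \<forall>z'\<in>Z. (G t \<circ> \<Psi>) z = (G t \<circ> \<Psi>) z')"
    proof (rule insert.IH[where G' = H'])
      show "card S < card (K - {j})"
        using insert.prems(1) insert.hyps x(2) finK by simp
      show "K - {j} \<subseteq> Basis" using insert.prems by blast
      show "open B" "q \<in> B" by fact+
      show "continuous_on B (\<lambda>z. H' t z v)" if "t \<in> S" for t v
        unfolding H'_def using that nz by (intro continuous_intros contG) auto
      show "(G t \<circ> \<Psi> has_derivative H' t z) (at z)" if "t \<in> S" "z \<in> B" for t z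
      proof -
        have derG: "(G t has_derivative G' t (\<Psi> z)) (at (\<Psi> z))"
          using der B(4) that by blast
        interpret bounded_linear "G' t (\<Psi> z)"
          using derG has_derivative_bounded_linear by blast
        show ?thesis
          using has_derivative_compose[OF der\<Psi>[OF \<open>z \<in> B\<close>] derG]
          by (simp add: add scaleR H'_def[abs_def] o_def)
      qed
    qed
    then obtain Z where Z: "Z \<subseteq> B" "infinite Z" "\<forall>z\<in>Z. \<forall>i\<in>Basis - (K - {j}). z \<bullet> i = q \<bullet> i"
        "\<forall>t\<in>S. \<forall>z\<in>Z. \<forall>z'\<in>Z. G t (\<Psi> z) = G t (\<Psi> z')"
      by auto
    have "infinite (\<Psi> ` Z)"
      using Z B(5) by (meson finite_imageD inj_on_subset)
    moreover have "\<Psi> ` Z \<subseteq> W" using Z(1) B(4) by blast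
    moreover have "\<Psi> z \<bullet> i = p \<bullet> i" if "z \<in> Z" "i \<in> Basis - K" for z i
    proof -
      have i: "i \<in> Basis - {j}" using that x(2) by auto
      have "\<Psi> z \<bullet> i = z \<bullet> i" using coord[OF _ i] that(1) Z(1) by blast
      also have "\<dots> = q \<bullet> i" using Z(3) that by blast
      also have "\<dots> = x \<bullet> i" using coord[OF \<open>q \<in> B\<close> i] B(3) by simp
      finally show ?thesis using x(3) that by simp
    qed
    moreover have "G t (\<Psi> z) = G t (\<Psi> z')" if "t \<in> insert s S" "z \<in> Z" "z' \<in> Z" for t z z'
    proof (cases "t = s")
      case True
      have "G s (\<Psi> y) = q \<bullet> j" if "y \<in> Z" for y
      proof -
        have "y \<in> B" using that Z(1) by blast
        moreover have "y \<bullet> j = q \<bullet> j" using Z(3) that \<open>j \<in> Basis\<close> by blast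
        ultimately show ?thesis using g\<Psi> by simp
      qed
      with that True show ?thesis by simp
    qed (use that Z(4) in blast)
    ultimately show ?thesis
      by (intro exI[of _ "\<Psi> ` Z"]) blast
  qed
qed

section \<open>Manifolds of equilibria\<close>

lemma smooth_on_component_derivative:
  fixes h :: "real ^ 'v::finite \<Rightarrow> real ^ 'v"
  assumes "smooth_on h W"
  defines "h' \<equiv> \<lambda>i x v. frechet_derivative h (at x) v $ i"
  shows "x \<in> W \<Longrightarrow> ((\<lambda>x. h x $ i) has_derivative h' i x) (at x)"
    and "continuous_on W (\<lambda>x. h' i x v)"
proof -
  have C1: "Ck_on (Suc 0) h W" using assms(1) unfolding smooth_on_def by blast
  show "((\<lambda>x. h x $ i) has_derivative h' i x) (at x)" if "x \<in> W"
    using C1 that unfolding h'_def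
    by (intro bounded_linear.has_derivative[OF bounded_linear_vec_nth])
       (simp add: frechet_derivative_works)
  show "continuous_on W (\<lambda>x. h' i x v)"
    using C1 unfolding h'_def by (intro continuous_on_component) simp
qed

text \<open>
  A manifold on which the projection to the coordinates in \<open>S\<close> has finite fibres has dimension at
  most \<open>card S\<close>: the inverse of a slice chart is injective, and with a smooth local lift its
  coordinates in \<open>S\<close> are \<open>C\<^sup>1\<close> functions of the parameters.
\<close>

lemma submanifold_dim_le_card:
  fixes M :: "('g::topological_space ^ 'v::finite) set"
  assumes M: "embedded_submanifold q k M"
    and fin: "\<And>Z. Z \<subseteq> M \<Longrightarrow> (\<And>s x y. s \<in> S \<Longrightarrow> x \<in> Z \<Longrightarrow> y \<in> Z \<Longrightarrow> x $ s = y $ s) \<Longrightarrow> finite Z"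
  shows "k \<le> card S"
proof (rule ccontr)
  assume "\<not> k \<le> card S"
  obtain p where "p \<in> M" using M by (auto simp: embedded_submanifold_def)
  then obtain U \<phi> K where chart: "p \<in> U" "smooth_chart q U \<phi>" "card K = k"
    and slice: "\<phi> ` (U \<inter> M) = \<phi> ` U \<inter> {y. \<forall>i. i \<notin> K \<longrightarrow> y $ i = 0}"
    using M unfolding embedded_submanifold_def by blast
  have inj: "inj_on \<phi> U" using chart(2) by (simp add: smooth_chart_def)
  define \<psi> where "\<psi> = inv_into U \<phi>"
  have "smooth_into q \<psi> (\<phi> ` U)" using chart(2) by (simp add: smooth_chart_def \<psi>_def)
  then obtain W h where W: "open W" "\<phi> p \<in> W" "W \<subseteq> \<phi> ` U" "smooth_on h W"
    and lift: "\<And>z. z \<in> W \<Longrightarrow> \<psi> z = cover q (h z)"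
    using \<open>p \<in> U\<close> unfolding smooth_into_def by (metis imageI)
  define K' where "K' = (\<lambda>i. axis i (1::real)) ` K"
  have "card K' = k"
    using chart(3) by (simp add: K'_def card_image inj_on_def axis_eq_axis)
  have "\<exists>Z\<subseteq>W. infinite Z \<and> (\<forall>z\<in>Z. \<forall>i\<in>Basis - K'. z \<bullet> i = \<phi> p \<bullet> i) \<and>
      (\<forall>s\<in>S. \<forall>z\<in>Z. \<forall>z'\<in>Z. h z $ s = h z' $ s)"
  proof (rule infinite_common_level_set)
    show "finite S" by simp
    show "card S < card K'" using \<open>\<not> k \<le> card S\<close> \<open>card K' = k\<close> by simp
    show "K' \<subseteq> Basis" by (auto simp: K'_def)
    show "open W" "\<phi> p \<in> W" by fact+
  qed (use smooth_on_component_derivative[OF W(4)] in blast)+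
  then obtain Z where Z: "Z \<subseteq> W" "infinite Z" "\<forall>z\<in>Z. \<forall>i\<in>Basis - K'. z \<bullet> i = \<phi> p \<bullet> i"
    "\<forall>s\<in>S. \<forall>z\<in>Z. \<forall>z'\<in>Z. h z $ s = h z' $ s"
    by blast
  have "z \<in> \<phi> ` (U \<inter> M)" if "z \<in> Z" for z
  proof -
    have "z $ i = 0" if "i \<notin> K" for i
    proof -
      have "axis i (1::real) \<in> Basis - K'"
        using that by (auto simp: K'_def axis_eq_axis)
      then have "z \<bullet> axis i 1 = \<phi> p \<bullet> axis i 1" using Z(3) \<open>z \<in> Z\<close> by blast
      then have "z $ i = \<phi> p $ i" by (simp add: inner_axis)
      moreover have "\<phi> p \<in> \<phi> ` (U \<inter> M)" using chart(1) \<open>p \<in> M\<close> by blast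
      ultimately show ?thesis using slice that by auto
    qed
    then show ?thesis using Z(1) W(3) that unfolding slice by blast
  qed
  then have "Z \<subseteq> \<phi> ` (U \<inter> M)" by blast
  then have "\<psi> ` Z \<subseteq> \<psi> ` \<phi> ` (U \<inter> M)" by (rule image_mono)
  also have "\<dots> \<subseteq> M"
    unfolding \<psi>_def using inj by simp
  finally have "\<psi> ` Z \<subseteq> M" .
  then have "finite (\<psi> ` Z)"
  proof (rule fin)
    fix s x y assume s: "s \<in> S" and xy: "x \<in> \<psi> ` Z" "y \<in> \<psi> ` Z"
    obtain z z' where z: "z \<in> Z" "x = \<psi> z" and z': "z' \<in> Z" "y = \<psi> z'"
      using xy by blast
    have "h z $ s = h z' $ s" using Z(4) s z(1) z'(1) by blast
    moreover have "x = cover q (h z)" "y = cover q (h z')"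
      using z z' Z(1) lift by blast+
    ultimately show "x $ s = y $ s" by (simp add: cover_def)
  qed
  moreover have "inj_on \<psi> Z"
    unfolding \<psi>_def by (rule inj_on_inv_into[OF subset_trans[OF Z(1) W(3)]])
  ultimately show False using Z(2) by (simp add: finite_image_iff)
qed

lemma equilibrium_manifold_dim_le:
  fixes f :: "'v::finite set \<Rightarrow> 'g::{topological_space, ab_group_add} \<Rightarrow> real"
  assumes "forced E S = UNIV"
    and "\<And>e y. e \<in> E \<Longrightarrow> finite (f e -` {y})"
    and "embedded_submanifold q k M" "M \<subseteq> equilibria E f \<omega>"
  shows "k \<le> card S"
proof (rule submanifold_dim_le_card[OF assms(3)])
  fix Z assume Z: "Z \<subseteq> M" and const: "\<And>s x y. s \<in> S \<Longrightarrow> x \<in> Z \<Longrightarrow> y \<in> Z \<Longrightarrow> x $ s = y $ s"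
  have known: "finite ((\<lambda>x. x $ s) ` Z)" if "s \<in> S" for s
  proof (cases "Z = {}")
    case False
    then obtain a where "a \<in> Z" by blast
    then have "(\<lambda>x. x $ s) ` Z \<subseteq> {a $ s}" using const that by blast
    then show ?thesis by (rule finite_subset) simp
  qed simp
  have "finite ((\<lambda>x. x $ t) ` Z)" for t
  proof (rule finite_forced_coordinate[where E = E and f = f and S = S])
    show "Z \<subseteq> equilibria E f \<omega>" using Z assms(4) by (rule subset_trans)
    show "t \<in> forced E S" using assms(1) by simp
    show "finite (f e -` {y})" if "e \<in> E" for e y using that by (rule assms(2))
    show "finite ((\<lambda>x. x $ s) ` Z)" if "s \<in> S" for s using that by (rule known)
  qed
  then show "finite Z" by (rule finite_if_finite_coordinates)
qed

lemma dim_an_le: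
  assumes "\<And>k M. embedded_submanifold q k M \<Longrightarrow> M \<subseteq> X \<Longrightarrow> real k \<le> b"
  shows "dim_an q X \<le> ereal b"
  unfolding dim_an_def
proof (rule Sup_least)
  fix x assume "x \<in> {ereal (real k) | k. \<exists>M. embedded_submanifold q k M \<and> M \<subseteq> X}"
  then obtain k M where "x = ereal (real k)" "embedded_submanifold q k M" "M \<subseteq> X" by blast
  then show "x \<le> ereal b" using assms[of k M] by simp
qed

lemma equilibria_dim_bound:
  fixes f :: "'v::finite set \<Rightarrow> 'g::{topological_space, ab_group_add} \<Rightarrow> real"
  assumes "forced E S = UNIV" and "\<And>e. e \<in> E \<Longrightarrow> fibres_bounded d (f e)"
  shows "dim_an q (equilibria E f \<omega>) \<le> ereal (real (card S)) \<and>
    (\<forall>k M. embedded_submanifold q k M \<and> M \<subseteq> equilibria E f \<omega> \<longrightarrow> real k \<le> real (card S))"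
proof -
  have "real k \<le> real (card S)" if "embedded_submanifold q k M" "M \<subseteq> equilibria E f \<omega>" for k M
    using equilibrium_manifold_dim_le[OF assms(1) _ that] assms(2) by (simp add: fibres_bounded_def)
  then show ?thesis by (intro conjI dim_an_le) auto
qed

theorem corollary28:
  fixes E :: "'v::finite set set"
    and \<omega> :: "real ^ 'v"
    and F :: "'v set"
    and d :: nat
  assumes "is_graph (UNIV :: 'v set) E"
    and "is_forest F (induced_edges E F)"
    and "isolated_vertices F (induced_edges E F) = {}"
  shows "let b = real CARD('v) - real (card F)
                 + real (card (leaves F (induced_edges E F)))
                 - real (card (connected_components F (induced_edges E F)))
         in (\<forall>f :: 'v set \<Rightarrow> real \<Rightarrow> real.
               (\<forall>e\<in>E. odd_function (f e) \<and> fibres_bounded d (f e)) \<longrightarrow>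
                 dim_an id (equilibria E f \<omega>) \<le> ereal b \<and>
                 (\<forall>k M. embedded_submanifold id k M \<and> M \<subseteq> equilibria E f \<omega> \<longrightarrow> real k \<le> b))
          \<and> (\<forall>f :: 'v set \<Rightarrow> circle \<Rightarrow> real.
               (\<forall>e\<in>E. odd_function (f e) \<and> fibres_bounded d (f e)) \<longrightarrow>
                 dim_an to_circle (equilibria E f \<omega>) \<le> ereal b \<and>
                 (\<forall>k M. embedded_submanifold to_circle k M \<and> M \<subseteq> equilibria E f \<omega> \<longrightarrow> real k \<le> b))"
proof -
  obtain S where S: "forced E S = UNIV"
    and card: "real (card S) = real CARD('v) - real (card F)
       + real (card (leaves F (induced_edges E F)))
       - real (card (connected_components F (induced_edges E F)))"
    using forcing_set_of_induced_forest[OF assms(2,3)] by blast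
  show ?thesis
    unfolding Let_def card[symmetric]
    by (rule conjI; intro allI; rule impI; rule equilibria_dim_bound[OF S, where d = d]; blast)
qed

end
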